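(* Let $W$ be an irreducible $T$-module with endpoint $r$ and diameter $d=D-2r$. Let $u\in E_rW$, $u^*\in E_r^*W$, $u^{\varepsilon}\in E_r^{\varepsilon}W$ be nonzero vectors. Then the following hold. (i) The matrix which represents $A$ with respect to the basis $E_ru^*,E_{r+1}u^*,\ldots,E_{r+d}u^*$ of $W$ and with respect to the basis $E_ru^{\varepsilon},E_{r+1}u^{\varepsilon},\ldots,E_{r+d}u^{\varepsilon}$ of $W$ is $\mathrm{diag}(d,d-2,d-4,\ldots,-d)$. (ii) The matrix which represents $A^*$ with respect to the basis $E^*_ru,E^*_{r+1}u,\ldots,E^*_{r+d}u$ of $W$ and with respect to the basis $E^*_ru^{\varepsilon},E^*_{r+1}u^{\varepsilon},\ldots,E^*_{r+d}u^{\varepsilon}$ of $W$ is $\mathrm{diag}(d,d-2,d-4,\ldots,-d)$. (iii) The matrix which represents $A^{\varepsilon}$ with respect to the basis $E^{\varepsilon}_ru,E^{\varepsilon}_{r+1}u,\ldots,E^{\varepsilon}_{r+d}u$ of $W$ and with respect to the basis $E^{\varepsilon}_ru^*,E^{\varepsilon}_{r+1}u^*,\ldots,E^{\varepsilon}_{r+d}u^*$ of $W$ is $\mathrm{diag}(d,d-2,d-4,\ldots,-d)$.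
   Context: Let $D$ be a positive integer and let $Q_D$ be the $D$-cube: the graph with vertex set $X=\{0,1\}^D$, two vertices being adjacent iff they differ in exactly one coordinate; $\partial$ denotes path-length distance. $\mathrm{Mat}_X(\mathbb{C})$ is the algebra of complex matrices with rows and columns indexed by $X$, acting on $V=\mathbb{C}^X$ (column vectors) by left multiplication. Write $\mathbf{i}^2=-1$. Let $A$ be the adjacency matrix of $Q_D$. Fix $x=(0,0,\ldots,0)\in X$. Let $A^*$ be the diagonal matrix in $\mathrm{Mat}_X(\mathbb{C})$ with $(y,y)$-entry $D-2\partial(x,y)$ for $y\in X$, and let $A^{\varepsilon}=-\mathbf{i}(AA^*-A^*A)/2$. Let $T$ be the subalgebra of $\mathrm{Mat}_X(\mathbb{C})$ generated by $A$ and $A^*$. The eigenvalues of $A$ are $\theta_i=D-2i$ $(0\le i\le D)$. For $0\le i\le D$: $E_i=\prod_{0\le j\le D,\,j\ne i}\frac{A-\theta_jI}{\theta_i-\theta_j}$ is the primitive idempotent of $A$ for $\theta_i$ (the orthogonal projection onto the $\theta_i$-eigenspace of $A$); $E_i^*$ is the diagonal matrix with $(y,y)$-entry $1$ if $\partial(x,y)=i$ and $0$ otherwise; and $E_i^{\varepsilon}=P^{-1}E_iP$, where $P=P_1^{\otimes D}$ (Kronecker power, $P_{yz}=\prod_{k=1}^D(P_1)_{y_kz_k}$, invertible) with $P_1=\begin{pmatrix}1&1\\-\mathbf{i}&\mathbf{i}\end{pmatrix}$, rows and columns indexed by $0,1$ in that order. ($E_i^*$ and $E_i^{\varepsilon}$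 are the primitive idempotents of $A^*$ and $A^{\varepsilon}$ for the eigenvalue $D-2i$.) A $T$-module is a subspace $W\subseteq V$ with $BW\subseteq W$ for all $B\in T$; it is irreducible if $W\ne0$ and it contains no $T$-modules other than $0$ and $W$. The endpoint of an irreducible $T$-module $W$ is $r=\min\{i\mid 0\le i\le D,\ E_i^*W\neq0\}$ (it is known that also $r=\min\{i\mid E_iW\ne0\}$), and its diameter is $d=|\{i\mid 0\le i\le D,\ E_i^*W\ne0\}|-1$; it is known that $d=D-2r$ and $0\le r\le D/2$. For nonzero $u\in E_rW$, $u^*\in E^*_rW$, $u^{\varepsilon}\in E^{\varepsilon}_rW$, each of the six sequences $(E^*_{r+i}u)_{i=0}^d$, $(E^{\varepsilon}_{r+i}u)_{i=0}^d$, $(E^{\varepsilon}_{r+i}u^* )_{i=0}^d$, $(E_{r+i}u^* )_{i=0}^d$, $(E_{r+i}u^{\varepsilon})_{i=0}^d$, $(E^*_{r+i}u^{\varepsilon})_{i=0}^d$ is a basis of $W$. Convention: a $(d+1)\times(d+1)$ matrix $B$ (rows and columns indexed $0,\ldots,d$) represents $Y\in T$ with respect to a basis $v_0,\ldots,v_d$ of $W$ if $Yv_j=\sum_{i=0}^dB_{ij}v_i$ for $0\le j\le d$. *)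

theory Defs
  imports "HOL-Analysis.Analysis"
begin

text \<open>
  The dimension is \<open>D = CARD('n)\<close>, and a vertex is an element of \<open>bool ^ 'n\<close>, with \<open>False\<close>, \<open>True\<close>
  standing for the coordinates 0, 1. Complex subspaces are \<open>vec.subspace\<close> and the matrix product is
  \<open>**\<close>; the library's \<open>subspace\<close> is only real-linear, and \<open>*\<close> on matrices is entrywise.
\<close>

type_synonym 'n vertex = "bool ^ 'n"
type_synonym 'n cvec = "complex ^ 'n vertex"
type_synonym 'n cmat = "complex ^ 'n vertex ^ 'n vertex"

definition smult_mat :: "complex \<Rightarrow> 'n::finite cmat \<Rightarrow> 'n cmat" where
  "smult_mat c M = (\<chi> y z. c * M $ y $ z)"

definition cube_adj :: "'n::finite vertex \<Rightarrow> 'n vertex \<Rightarrow> bool" where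
  "cube_adj y z \<longleftrightarrow> (\<exists>!k. y $ k \<noteq> z $ k)"

definition cube_dist :: "'n::finite vertex \<Rightarrow> 'n vertex \<Rightarrow> nat" where
  "cube_dist y z = (LEAST m. (cube_adj ^^ m) y z)"

definition base_vertex :: "'n::finite vertex" where
  "base_vertex = (\<chi> k. False)"

definition A_mat :: "'n::finite cmat" where
  "A_mat = (\<chi> y z. if cube_adj y z then 1 else 0)"

definition Astar_mat :: "'n::finite cmat" where
  "Astar_mat = (\<chi> y z. if y = z
     then of_nat CARD('n) - 2 * of_nat (cube_dist base_vertex y) else 0)"

definition Aeps_mat :: "'n::finite cmat" where
  "Aeps_mat = smult_mat (- \<i> / 2) (A_mat ** Astar_mat - Astar_mat ** A_mat)"

definition is_subalgebra :: "'n::finite cmat set \<Rightarrow> bool" where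
  "is_subalgebra S \<longleftrightarrow> mat 1 \<in> S \<and>
     (\<forall>M\<in>S. \<forall>N\<in>S. M + N \<in> S \<and> M ** N \<in> S) \<and> (\<forall>c. \<forall>M\<in>S. smult_mat c M \<in> S)"

definition T_alg :: "'n::finite cmat set" where
  "T_alg = is_subalgebra hull {A_mat, Astar_mat}"

definition theta :: "'n::finite itself \<Rightarrow> nat \<Rightarrow> complex" where
  "theta _ i = of_nat CARD('n) - 2 * of_nat i"

text \<open>The product over \<open>j \<noteq> i\<close> is an ordered one over \<open>j = 0, \<dots>, D\<close>; its factors commute.\<close>

definition E_mat :: "nat \<Rightarrow> 'n::finite cmat" where
  "E_mat i = foldr (**)
     (map (\<lambda>j. smult_mat (1 / (theta TYPE('n) i - theta TYPE('n) j))
                 (A_mat - smult_mat (theta TYPE('n) j) (mat 1)))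
       (filter (\<lambda>j. j \<noteq> i) [0..<Suc CARD('n)])) (mat 1)"

definition Estar_mat :: "nat \<Rightarrow> 'n::finite cmat" where
  "Estar_mat i = (\<chi> y z. if y = z \<and> cube_dist base_vertex y = i then 1 else 0)"

definition P1 :: "bool \<Rightarrow> bool \<Rightarrow> complex" where
  "P1 a b = (if \<not> a then 1 else if \<not> b then - \<i> else \<i>)"

definition P_mat :: "'n::finite cmat" where
  "P_mat = (\<chi> y z. \<Prod>k\<in>UNIV. P1 (y $ k) (z $ k))"

definition Eeps_mat :: "nat \<Rightarrow> 'n::finite cmat" where
  "Eeps_mat i = matrix_inv P_mat ** E_mat i ** P_mat"

definition T_module :: "'n::finite cvec set \<Rightarrow> bool" where
  "T_module W \<longleftrightarrow> vec.subspace W \<and> (\<forall>B\<in>T_alg. \<forall>w\<in>W. B *v w \<in> W)"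

definition irreducible_T_module :: "'n::finite cvec set \<Rightarrow> bool" where
  "irreducible_T_module W \<longleftrightarrow> T_module W \<and> W \<noteq> {0} \<and>
     (\<forall>U. T_module U \<and> U \<subseteq> W \<longrightarrow> U = {0} \<or> U = W)"

definition mat_image :: "'n::finite cmat \<Rightarrow> 'n cvec set \<Rightarrow> 'n cvec set" where
  "mat_image M W = (\<lambda>w. M *v w) ` W"

definition module_support :: "'n::finite cvec set \<Rightarrow> nat set" where
  "module_support W = {i. i \<le> CARD('n) \<and> mat_image (Estar_mat i) W \<noteq> {0}}"

definition endpoint :: "'n::finite cvec set \<Rightarrow> nat" where
  "endpoint W = Min (module_support W)"

definition diameter_mod :: "'n::finite cvec set \<Rightarrow> nat" where
  "diameter_mod W = card (module_support W) - 1"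

definition is_basis_seq :: "nat \<Rightarrow> (nat \<Rightarrow> 'n::finite cvec) \<Rightarrow> 'n cvec set \<Rightarrow> bool" where
  "is_basis_seq d v W \<longleftrightarrow>
     inj_on v {0..d} \<and> vec.independent (v ` {0..d}) \<and> vec.span (v ` {0..d}) = W"

text \<open>
  \<open>represents d B Y v W\<close>: the vectors \<open>v 0, \<dots>, v d\<close> form a basis of \<open>W\<close>, and the
  \<open>(d+1) \<times> (d+1)\<close> matrix with entries \<open>B i j\<close> for \<open>i, j \<le> d\<close> represents \<open>Y\<close> with respect to it.
  The size depends on \<open>W\<close>, hence \<open>B\<close> is a function on indices.
\<close>

definition represents ::
  "nat \<Rightarrow> (nat \<Rightarrow> nat \<Rightarrow> complex) \<Rightarrow> 'n::finite cmat \<Rightarrow> (nat \<Rightarrow> 'n cvec) \<Rightarrow> 'n cvec set \<Rightarrow> bool" where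
  "represents d B Y v W \<longleftrightarrow> is_basis_seq d v W \<and>
     (\<forall>j\<le>d. Y *v v j = (\<Sum>i=0..d. B i j *s v i))"

definition diag_mat :: "nat \<Rightarrow> nat \<Rightarrow> nat \<Rightarrow> complex" where
  "diag_mat d i j = (if i = j then of_nat d - 2 * of_nat i else 0)"

end

theory Submission
  imports Defs
begin

text \<open>
  The matrices \<open>A\<close>, \<open>A\<^sup>*\<close>, \<open>A\<^sup>\<epsilon>\<close> satisfy the relations \<open>[X, Y] = c Z\<close> with \<open>c\<^sup>2 = - 4\<close>, cyclically, so
  they span a copy of \<open>sl\<^sub>2\<close>, and each of them is diagonalizable with eigenvalues \<open>D - 2 i\<close>. Weight theory
  on an irreducible module \<open>W\<close> of dimension \<open>d + 1\<close> shows that each has the simple eigenvalues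
  \<open>d, d - 2, \<dots>, - d\<close> on \<open>W\<close>, whence the three endpoints agree and \<open>D = 2 r + d\<close>. A highest weight vector
  \<open>u\<close> of \<open>X\<close> is cyclic for \<open>Y\<close>, so every component of \<open>u\<close> in the eigenspaces of \<open>Y\<close> on \<open>W\<close> is nonzero,
  and these components form an eigenbasis of \<open>W\<close>.
\<close>

section \<open>Spectral families and Lagrange interpolation\<close>

definition ev :: "nat \<Rightarrow> nat \<Rightarrow> complex" where
  "ev D i = of_nat D - 2 * of_nat i"

lemma ev_inject [simp]: "ev D i = ev D j \<longleftrightarrow> i = j"
  by (simp add: ev_def)

lemma ev_Suc: "ev D (Suc i) = ev D i - 2"
  by (simp add: ev_def)

text \<open>The polynomial of \<open>E_mat\<close>, applied to a vector factor by factor, so that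
  its properties follow by induction over the list of factors.\<close>

definition lagrange_proj ::
  "nat \<Rightarrow> complex ^ 'm ^ 'm \<Rightarrow> nat \<Rightarrow> complex ^ 'm::finite \<Rightarrow> complex ^ 'm" where
  "lagrange_proj D X i w =
     foldr (\<lambda>j v. (1 / (ev D i - ev D j)) *s (X *v v - ev D j *s v))
       (filter (\<lambda>j. j \<noteq> i) [0..<Suc D]) w"

text \<open>What is used of the primitive idempotents of \<open>X\<close>. As the values
  \<open>ev D i\<close> are distinct, idempotency and orthogonality for indices up to
  \<open>D\<close> follow.\<close>

locale spectral_family =
  fixes D :: nat and X :: "complex ^ 'm::finite ^ 'm" and F :: "nat \<Rightarrow> complex ^ 'm ^ 'm"
  assumes eigen_left: "i \<le> D \<Longrightarrow> X *v (F i *v v) = ev D i *s (F i *v v)"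
    and eigen_right: "i \<le> D \<Longrightarrow> F i *v (X *v v) = ev D i *s (F i *v v)"
    and resolution: "(\<Sum>i\<le>D. F i *v v) = v"
begin

text \<open>Applying \<open>F k\<close> to the eigenvector equation gives
  \<open>ev D k = ev D j\<close> unless \<open>F k *v w = 0\<close>, so only the \<open>j\<close>-th
  term of the resolution survives.\<close>

lemma proj_eigenvector:
  assumes "X *v w = ev D j *s w" "i \<le> D" "j \<le> D"
  shows "F i *v w = (if i = j then w else 0)"
proof -
  have off: "F k *v w = 0" if "k \<le> D" "k \<noteq> j" for k
  proof -
    have "ev D k *s (F k *v w) = ev D j *s (F k *v w)"
      using eigen_right[OF that(1), of w] unfolding assms(1) by (simp only: vec.scale)
    then show ?thesis using that vec.scale_right_imp_eq ev_inject by metis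
  qed
  have "w = (\<Sum>k\<le>D. F k *v w)" by (simp add: resolution)
  also have "\<dots> = (\<Sum>k\<le>D. if k = j then F j *v w else 0)"
    by (rule sum.cong) (auto simp: off)
  finally have "F j *v w = w" using assms(3) by simp
  then show ?thesis using off assms(2) by auto
qed

lemma eigenvalueE:
  assumes "X *v w = \<mu> *s w" "w \<noteq> 0"
  obtains i where "i \<le> D" "\<mu> = ev D i" "F i *v w = w"
proof -
  have "\<exists>i\<le>D. F i *v w \<noteq> 0"
    using resolution[of w] assms(2) by (metis atMost_iff sum.neutral)
  then obtain i where i: "i \<le> D" "F i *v w \<noteq> 0" by blast
  have "ev D i *s (F i *v w) = \<mu> *s (F i *v w)"
    using eigen_right[OF i(1), of w] unfolding assms(1) by (simp only: vec.scale)
  then have "\<mu> = ev D i" using i(2) by (metis vec.scale_right_imp_eq)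
  moreover then have "F i *v w = w" using proj_eigenvector[of w i i] assms i by simp
  ultimately show thesis using that i by blast
qed

text \<open>\<open>F k\<close> turns the factors into scalars, whose product is the Lagrange
  polynomial of node \<open>i\<close> at node \<open>k\<close>, that is 1 or 0. Hence
  \<open>X\<close> determines the family.\<close>

lemma lagrange_proj_eq:
  assumes "i \<le> D"
  shows "lagrange_proj D X i w = F i *v w"
proof -
  let ?f = "\<lambda>j v. (1 / (ev D i - ev D j)) *s (X *v v - ev D j *s v)"
  have fold: "F k *v foldr ?f xs w
      = (\<Prod>j\<leftarrow>xs. (ev D k - ev D j) / (ev D i - ev D j)) *s (F k *v w)"
    if "k \<le> D" for k xs
    using eigen_right[OF that]
    by (induction xs)
      (simp_all add: vec.scale vec.diff vec_eq_iff divide_inverse algebra_simps)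
  have "F k *v lagrange_proj D X i w = (if k = i then F i *v w else 0)" if "k \<le> D" for k
  proof (cases "k = i")
    case True
    have "(\<Prod>j\<leftarrow>filter (\<lambda>j. j \<noteq> i) xs. (ev D i - ev D j) / (ev D i - ev D j)) = 1"
      for xs by (induction xs) auto
    then show ?thesis
      unfolding lagrange_proj_def fold[OF that] by (simp only: True vec.scale_one refl if_True)
  next
    case False
    then have "(\<Prod>j\<leftarrow>filter (\<lambda>j. j \<noteq> i) [0..<Suc D]. (ev D k - ev D j) / (ev D i - ev D j)) = 0"
      using that by (intro prod_list_zero_iff[THEN iffD2]) force
    then show ?thesis
      unfolding lagrange_proj_def fold[OF that] by (simp only: False vec.scale_zero_left if_False)
  qed
  then have "(\<Sum>k\<le>D. F k *v lagrange_proj D X i w) = (\<Sum>k\<le>D. if k = i then F i *v w else 0)"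
    by (intro sum.cong) auto
  then show ?thesis using assms by (simp add: resolution)
qed

lemma proj_in_invariant_subspace:
  assumes "vec.subspace W" "\<And>w. w \<in> W \<Longrightarrow> X *v w \<in> W" "w \<in> W" "i \<le> D"
  shows "F i *v w \<in> W"
proof -
  have "foldr (\<lambda>j v. (1 / (ev D i - ev D j)) *s (X *v v - ev D j *s v)) xs w \<in> W" for xs
  proof (induction xs)
    case (Cons j xs)
    show ?case unfolding foldr.simps comp_def
      by (intro vec.subspace_scale vec.subspace_diff assms(1,2) Cons)
  qed (simp add: assms(3))
  then have "lagrange_proj D X i w \<in> W" unfolding lagrange_proj_def .
  then show ?thesis by (simp only: lagrange_proj_eq[OF assms(4)])
qed

text \<open>\<open>F (s + j)\<close> fixes \<open>v j\<close> and kills the other vectors, so it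
  extracts one coefficient from a linear relation.\<close>

lemma eigenvectors_independent:
  assumes "\<And>i. i \<le> n \<Longrightarrow> v i \<noteq> 0" "\<And>i. i \<le> n \<Longrightarrow> X *v v i = ev D (s + i) *s v i"
  shows "inj_on v {0..n}" "vec.independent (v ` {0..n})"
proof -
  \<comment> \<open>A nonzero eigenvector forces its eigenvalue to be an \<open>ev D i\<close> with
    \<open>i \<le> D\<close>, so the indices stay in range.\<close>
  have bound: "s + i \<le> D" if "i \<le> n" for i
    using eigenvalueE[OF assms(2)[OF that] assms(1)[OF that]] by (metis ev_inject)
  have orth: "F (s + j) *v v i = (if i = j then v i else 0)" if "i \<le> n" "j \<le> n" for i j
    using proj_eigenvector[of "v i" "s + i" "s + j"] assms(2) bound that by auto
  show inj: "inj_on v {0..n}"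
    by (rule inj_onI) (metis orth assms(1) atLeastAtMost_iff)
  show "vec.independent (v ` {0..n})"
  proof (rule vec.independent_if_scalars_zero)
    fix f x assume sum0: "(\<Sum>x\<in>v ` {0..n}. f x *s x) = 0" and "x \<in> v ` {0..n}"
    then obtain j where j: "j \<le> n" "x = v j" by auto
    have "0 = F (s + j) *v (\<Sum>x\<in>v ` {0..n}. f x *s x)" by (simp add: sum0)
    also have "\<dots> = (\<Sum>i\<in>{0..n}. f (v i) *s (F (s + j) *v v i))"
      by (simp add: vec.sum vec.scale sum.reindex[OF inj])
    also have "\<dots> = (\<Sum>i\<in>{0..n}. if i = j then f (v j) *s v j else 0)"
      by (rule sum.cong) (auto simp: orth j)
    also have "\<dots> = f x *s x" using j by simp
    finally show "f x = 0" using assms(1) j by simp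
  qed simp
qed

end

section \<open>Irreducible modules\<close>

lemma span_closed_under:
  assumes "\<And>b. b \<in> B \<Longrightarrow> M *v b \<in> vec.span B" "w \<in> vec.span B"
  shows "M *v w \<in> vec.span (B :: (complex ^ 'm::finite) set)"
  using assms(2)
  by (induction rule: vec.span_induct_alt)
    (auto simp: vec.add vec.scale intro!: vec.span_add vec.span_scale vec.span_zero assms(1))

text \<open>\<open>X\<close> plays the Cartan element. \<open>c\<close> may be either root of
  \<open>c * c = - 4\<close>, which absorbs the sign when two generators trade places.\<close>

locale su2_module = spectral_family D X F
  for D and X :: "complex ^ 'm::finite ^ 'm" and F +
  fixes Y Z :: "complex ^ 'm ^ 'm" and c :: complex and W :: "(complex ^ 'm) set"
  assumes c_square: "c * c = - 4"
    and XY: "X *v (Y *v v) - Y *v (X *v v) = c *s (Z *v v)"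
    and YZ: "Y *v (Z *v v) - Z *v (Y *v v) = c *s (X *v v)"
    and ZX: "Z *v (X *v v) - X *v (Z *v v) = c *s (Y *v v)"
    and subspace: "vec.subspace W"
    and closed: "w \<in> W \<Longrightarrow> X *v w \<in> W" "w \<in> W \<Longrightarrow> Y *v w \<in> W" "w \<in> W \<Longrightarrow> Z *v w \<in> W"
    and nontrivial: "W \<noteq> {0}"
    and irreducible: "\<And>U. \<lbrakk>vec.subspace U; U \<subseteq> W; \<And>w. w \<in> U \<Longrightarrow> X *v w \<in> U;
        \<And>w. w \<in> U \<Longrightarrow> Y *v w \<in> U; \<And>w. w \<in> U \<Longrightarrow> Z *v w \<in> U\<rbrakk> \<Longrightarrow> U = {0} \<or> U = W"
begin

section \<open>Ladder operators and the weights of an irreducible module\<close>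

definition raise :: "complex ^ 'm \<Rightarrow> complex ^ 'm" where
  "raise v = Y *v v + (c / 2) *s (Z *v v)"

definition lower :: "complex ^ 'm \<Rightarrow> complex ^ 'm" where
  "lower v = Y *v v - (c / 2) *s (Z *v v)"

lemma c_cancel: "c * (c * a) = - 4 * a"
  by (metis c_square mult.assoc)

text \<open>The condition \<open>c * c = - 4\<close> makes \<open>raise\<close> and
  \<open>lower\<close> eigenvectors of commutation with \<open>X\<close>. They are twice the
  standard \<open>e\<close> and \<open>f\<close> of sl2, with \<open>X\<close> as
  \<open>h\<close>.\<close>

lemma
  shows X_raise: "X *v raise v = raise (X *v v) + 2 *s raise v"
    and X_lower: "X *v lower v = lower (X *v v) - 2 *s lower v"
    and raise_lower: "raise (lower v) = lower (raise v) + 4 *s (X *v v)"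
proof -
  have 1: "X *v (Y *v v) = Y *v (X *v v) + c *s (Z *v v)" using XY[of v] by (simp add: algebra_simps)
  have 2: "X *v (Z *v v) = Z *v (X *v v) - c *s (Y *v v)" using ZX[of v] by (simp add: algebra_simps)
  have 3: "Y *v (Z *v v) = Z *v (Y *v v) + c *s (X *v v)" using YZ[of v] by (simp add: algebra_simps)
  show "X *v raise v = raise (X *v v) + 2 *s raise v"
    "X *v lower v = lower (X *v v) - 2 *s lower v"
    "raise (lower v) = lower (raise v) + 4 *s (X *v v)"
    unfolding raise_def lower_def
    by (simp_all add: vec.add vec.diff vec.scale 1 2 3 vec_eq_iff algebra_simps c_cancel)
qed

lemma raise_scale: "raise (a *s v) = a *s raise v"
  by (simp add: raise_def vec.scale vec_eq_iff algebra_simps)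

lemma lower_scale: "lower (a *s v) = a *s lower v"
  by (simp add: lower_def vec.scale vec_eq_iff algebra_simps)

lemma lower_zero: "lower 0 = 0"
  by (simp add: lower_def)

lemma raise_closed: "w \<in> W \<Longrightarrow> raise w \<in> W"
  by (auto simp: raise_def intro!: vec.subspace_add vec.subspace_scale subspace closed)

lemma lower_closed: "w \<in> W \<Longrightarrow> lower w \<in> W"
  by (auto simp: lower_def intro!: vec.subspace_diff vec.subspace_scale subspace closed)

lemma Y_eq: "Y *v v = (1 / 2) *s (raise v + lower v)"
  by (simp add: raise_def lower_def vec_eq_iff)

lemma Z_eq: "Z *v v = (1 / c) *s (raise v - lower v)"
proof -
  have "c \<noteq> 0" using c_square by auto
  then show ?thesis by (simp add: raise_def lower_def vec_eq_iff)
qed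

text \<open>Raising adds 2 to the eigenvalue, which decreases the index by one. Index
  \<open>s - 1\<close> does not occur on \<open>W\<close>, and for \<open>s = 0\<close> the new
  value is no eigenvalue of \<open>X\<close> at all.\<close>

lemma raise_highest:
  assumes "u \<in> W" "X *v u = ev D s *s u" "\<And>i w. \<lbrakk>i < s; i \<le> D; w \<in> W\<rbrakk> \<Longrightarrow> F i *v w = 0"
  shows "raise u = 0"
proof (rule ccontr)
  assume nz: "raise u \<noteq> 0"
  moreover have "X *v raise u = (ev D s + 2) *s raise u"
    by (simp add: X_raise assms(2) raise_scale vec_eq_iff algebra_simps)
  ultimately obtain i where i: "i \<le> D" "ev D s + 2 = ev D i" "F i *v raise u = raise u"
    using eigenvalueE by metis
  then have "ev D s = ev D (Suc i)" by (simp add: ev_Suc algebra_simps)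
  then have "i < s" by simp
  then show False using assms(3)[of i "raise u"] i raise_closed[OF assms(1)] nz by simp
qed

text \<open>The lowering string of a highest weight vector spans an invariant subspace, which is
  \<open>W\<close> by irreducibility. The place where the string stops gives \<open>n\<close> and
  the relation \<open>D = 2 * s + n\<close>.\<close>

lemma weights:
  obtains s n where "D = 2 * s + n" "vec.dim W = Suc n"
    "\<And>i. i \<le> D \<Longrightarrow> (\<exists>w\<in>W. F i *v w \<noteq> 0) \<longleftrightarrow> s \<le> i \<and> i \<le> s + n"
proof -
  let ?supp = "\<lambda>i. i \<le> D \<and> (\<exists>w\<in>W. F i *v w \<noteq> 0)"
  obtain w0 where w0: "w0 \<in> W" "w0 \<noteq> 0"
    using nontrivial subspace vec.subspace_0 by blast
  then have "\<exists>i. ?supp i"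
    using resolution[of w0] by (metis atMost_iff sum.neutral)
  \<comment> \<open>The least index belongs to the largest eigenvalue, so \<open>h\<close> below is
    a highest weight vector.\<close>
  define s where "s = (LEAST i. ?supp i)"
  have s: "?supp s" and s_min: "\<And>i. ?supp i \<Longrightarrow> s \<le> i"
    unfolding s_def using LeastI_ex[OF \<open>\<exists>i. ?supp i\<close>] by (auto intro: Least_le)
  then obtain w1 where w1: "w1 \<in> W" "F s *v w1 \<noteq> 0" by blast
  define h where "h = F s *v w1"
  have hW: "h \<in> W" and h0: "h \<noteq> 0" and Xh: "X *v h = ev D s *s h"
    using w1 s proj_in_invariant_subspace[OF subspace closed(1)] eigen_left by (auto simp: h_def)
  have "raise h = 0"
    by (rule raise_highest[OF hW Xh]) (metis s_min not_le)
  define l where "l k = (lower ^^ k) h" for k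
  have l_Suc: "l (Suc k) = lower (l k)" and l_0: "l 0 = h" for k by (simp_all add: l_def)
  have lW: "l k \<in> W" for k by (induction k) (auto simp: l_Suc l_0 hW lower_closed)
  have Xl: "X *v l k = ev D (s + k) *s l k" for k
  proof (induction k)
    case (Suc k)
    have "X *v l (Suc k) = ev D (s + k) *s l (Suc k) - 2 *s l (Suc k)"
      by (simp only: l_Suc X_lower Suc lower_scale)
    then show ?case by (simp add: ev_Suc vec_eq_iff algebra_simps)
  qed (simp add: l_0 Xh)
  \<comment> \<open>Each use of \<open>raise_lower\<close> contributes
    \<open>4 * ev D (s + m)\<close>; summing over \<open>m = 0, ..., k\<close> gives this
    coefficient.\<close>
  have Rl: "raise (l (Suc k)) = (4 * of_nat (Suc k) * (ev D s - of_nat k)) *s l k" for k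
  proof (induction k)
    case 0
    show ?case by (simp add: l_Suc l_0 raise_lower \<open>raise h = 0\<close> lower_zero Xh)
  next
    case (Suc k)
    have "raise (l (Suc (Suc k))) = lower (raise (l (Suc k))) + 4 *s (X *v l (Suc k))"
      by (subst l_Suc) (rule raise_lower)
    then show ?case
      by (simp only: Suc lower_scale Xl l_Suc[symmetric]) (simp add: ev_def vec_eq_iff algebra_simps)
  qed
  let ?U = "vec.span (range l)"
  have U_l: "l k \<in> ?U" for k by (simp add: vec.span_base)
  have U_lower: "lower (l k) \<in> ?U" for k using U_l[of "Suc k"] by (simp add: l_Suc)
  have U_raise: "raise (l k) \<in> ?U" for k
    by (cases k) (auto simp: Rl l_0 \<open>raise h = 0\<close> intro!: vec.span_scale vec.span_zero U_l)
  have "?U = {0} \<or> ?U = W"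
  proof (rule irreducible)
    show "?U \<subseteq> W" using lW by (intro vec.span_minimal subspace) auto
    fix w assume w: "w \<in> ?U"
    show "X *v w \<in> ?U"
      by (rule span_closed_under[OF _ w]) (auto simp only: Xl intro!: vec.span_scale U_l)
    show "Y *v w \<in> ?U"
      by (rule span_closed_under[OF _ w])
        (auto simp: Y_eq intro!: vec.span_scale vec.span_add U_raise U_lower)
    show "Z *v w \<in> ?U"
      by (rule span_closed_under[OF _ w])
        (auto simp: Z_eq intro!: vec.span_scale vec.span_diff U_raise U_lower)
  qed simp
  then have UW: "?U = W" using U_l[of 0] h0 by (auto simp: l_0)
  have l_bound: "s + k \<le> D" if "l k \<noteq> 0" for k
    using eigenvalueE[OF Xl that] by (metis ev_inject)
  \<comment> \<open>\<open>l (Suc D)\<close> would have an index beyond \<open>D\<close>, so it is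
    zero.\<close>
  then have ex: "\<exists>k. l k = 0" using l_bound[of "Suc D"] by fastforce
  obtain n where n: "l (Suc n) = 0" and ln: "\<And>k. k \<le> n \<Longrightarrow> l k \<noteq> 0"
  proof -
    have LK: "l (LEAST k. l k = 0) = 0" by (rule LeastI_ex[OF ex])
    then have "(LEAST k. l k = 0) \<noteq> 0" using h0 l_0 by metis
    then obtain n where n: "(LEAST k. l k = 0) = Suc n" using not0_implies_Suc by blast
    have below: "l k \<noteq> 0" if "k \<le> n" for k
      using not_less_Least[of k "\<lambda>k. l k = 0"] that by (simp add: n)
    show thesis by (rule that[OF _ below]) (use LK n in simp_all)
  qed
  have "raise 0 = 0" by (simp add: raise_def)
  \<comment> \<open>Raising \<open>l (Suc n) = 0\<close> gives a multiple of the nonzero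
    \<open>l n\<close>, so the coefficient vanishes. This ties the highest eigenvalue to the length
    of the string.\<close>
  then have "4 * of_nat (Suc n) * (ev D s - of_nat n) = 0"
    using Rl[of n] n ln[of n] by simp
  then have "ev D s = of_nat n" by (simp del: of_nat_Suc)
  then have "(of_nat D :: complex) = of_nat (2 * s + n)" by (simp add: ev_def algebra_simps)
  then have D: "D = 2 * s + n" using of_nat_eq_iff by blast
  have l_tail: "l k = 0" if "k > n" for k
    using that
  proof (induction k)
    case (Suc k)
    then show ?case using n by (cases "k = n") (simp_all add: l_Suc lower_zero)
  qed simp
  have "l k \<in> insert 0 (l ` {0..n})" for k
    using l_tail[of k] by (cases "k \<le> n") auto
  then have "?U \<subseteq> vec.span (insert 0 (l ` {0..n}))"
    by (intro vec.span_mono) auto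
  moreover have "vec.span (l ` {0..n}) \<subseteq> ?U" by (intro vec.span_mono) auto
  ultimately have span_l: "vec.span (l ` {0..n}) = W"
    by (simp add: UW vec.span_insert_0)
  have "inj_on l {0..n}" "vec.independent (l ` {0..n})"
    using eigenvectors_independent[of n l s] ln Xl by auto
  then have dim: "vec.dim W = Suc n"
    using vec.dim_span_eq_card_independent[of "l ` {0..n}"] by (simp add: span_l card_image)
  have "(\<exists>w\<in>W. F i *v w \<noteq> 0) \<longleftrightarrow> s \<le> i \<and> i \<le> s + n" if i: "i \<le> D" for i
  proof
    assume "s \<le> i \<and> i \<le> s + n"
    then obtain k where k: "i = s + k" "k \<le> n" by (auto simp: le_iff_add)
    then have "F i *v l k = l k" using proj_eigenvector[OF Xl i, of k] i by simp
    then show "\<exists>w\<in>W. F i *v w \<noteq> 0" using ln[OF k(2)] lW by metis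
  next
    assume "\<exists>w\<in>W. F i *v w \<noteq> 0"
    then obtain w where w: "w \<in> W" "F i *v w \<noteq> 0" by blast
    show "s \<le> i \<and> i \<le> s + n"
    proof (rule ccontr)
      assume out: "\<not> (s \<le> i \<and> i \<le> s + n)"
      have "F i *v l k = 0" if "k \<le> n" for k
        using proj_eigenvector[OF Xl i, of k] out that l_bound[OF ln[OF that]] by auto
      then have "vec.span (l ` {0..n}) \<subseteq> {w. F i *v w = 0}"
        by (intro vec.span_minimal vec.subspace_kernel) auto
      then show False using w span_l by blast
    qed
  qed
  then show thesis using that D dim by blast
qed

section \<open>Exchanging the roles of the three generators\<close>

lemma spectral_swap:
  assumes "spectral_family D Y G"
  shows "su2_module D Y G X Z (- c) W"
proof -
  interpret G: spectral_family D Y G by fact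
  show ?thesis
  proof
    fix v
    show "Y *v (X *v v) - X *v (Y *v v) = - c *s (Z *v v)"
      "X *v (Z *v v) - Z *v (X *v v) = - c *s (Y *v v)"
      "Z *v (Y *v v) - Y *v (Z *v v) = - c *s (X *v v)"
      using XY[of v] YZ[of v] ZX[of v] by (simp_all add: vec_eq_iff algebra_simps)
  next
    fix U
    assume "vec.subspace U" "U \<subseteq> W" "\<And>w. w \<in> U \<Longrightarrow> Y *v w \<in> U" "\<And>w. w \<in> U \<Longrightarrow> X *v w \<in> U"
      "\<And>w. w \<in> U \<Longrightarrow> Z *v w \<in> U"
    then show "U = {0} \<or> U = W" by (intro irreducible)
  qed (simp_all add: c_square subspace closed nontrivial)
qed

text \<open>A transposition reverses every commutator, hence \<open>- c\<close>. Together with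
  \<open>spectral_swap\<close> this reaches all orderings of the generators, given a spectral family
  for each.\<close>

lemma swap_YZ: "su2_module D X F Z Y (- c) W"
proof
  fix v
  show "X *v (Z *v v) - Z *v (X *v v) = - c *s (Y *v v)"
    "Z *v (Y *v v) - Y *v (Z *v v) = - c *s (X *v v)"
    "Y *v (X *v v) - X *v (Y *v v) = - c *s (Z *v v)"
    using XY[of v] YZ[of v] ZX[of v] by (simp_all add: vec_eq_iff algebra_simps)
next
  fix U
  assume "vec.subspace U" "U \<subseteq> W" "\<And>w. w \<in> U \<Longrightarrow> X *v w \<in> U" "\<And>w. w \<in> U \<Longrightarrow> Z *v w \<in> U"
    "\<And>w. w \<in> U \<Longrightarrow> Y *v w \<in> U"
  then show "U = {0} \<or> U = W" by (intro irreducible)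
qed (simp_all add: c_square subspace closed nontrivial)

text \<open>The reason is that \<open>raise u = 0\<close> makes \<open>Z u\<close> a multiple of \<open>Y u\<close>; commuting \<open>X\<close> and \<open>Z\<close> past
  powers of \<open>Y\<close> then stays in the span.\<close>

lemma highest_vector_cyclic:
  assumes "u \<in> W" "u \<noteq> 0" "X *v u = \<mu> *s u" "raise u = 0"
  shows "vec.span (range (\<lambda>k. (((*v) Y) ^^ k) u)) = W"
proof -
  define p where "p k = (((*v) Y) ^^ k) u" for k
  have p_Suc: "p (Suc k) = Y *v p k" and p_0: "p 0 = u" for k by (simp_all add: p_def)
  have pW: "p k \<in> W" for k by (induction k) (simp_all add: p_Suc p_0 assms(1) closed)
  let ?U = "vec.span (range p)"
  have U_p: "p k \<in> ?U" for k by (simp add: vec.span_base)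
  have U_Y: "Y *v w \<in> ?U" if "w \<in> ?U" for w
    by (rule span_closed_under[OF _ that]) (auto simp: p_Suc[symmetric] U_p)
  have XZ: "X *v p k \<in> ?U \<and> Z *v p k \<in> ?U" for k
  proof (induction k)
    case 0
    have "lower u = 2 *s (Y *v u)"
      using Y_eq[of u] assms(4) by simp
    then have "Z *v u = (- 2 / c) *s (Y *v u)"
      using Z_eq[of u] assms(4) by (simp add: vec_eq_iff)
    then show ?case
      using U_Y[OF U_p[of 0]] U_p[of 0] by (simp add: p_0 assms(3) vec.span_scale vec.span_neg)
  next
    case (Suc k)
    have "X *v p (Suc k) = Y *v (X *v p k) + c *s (Z *v p k)"
      "Z *v p (Suc k) = Y *v (Z *v p k) - c *s (X *v p k)"
      using XY[of "p k"] YZ[of "p k"] by (simp_all add: p_Suc algebra_simps)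
    then show ?case using Suc U_Y by (simp add: vec.span_add vec.span_diff vec.span_scale)
  qed
  have "?U = {0} \<or> ?U = W"
  proof (rule irreducible)
    show "?U \<subseteq> W" using pW by (intro vec.span_minimal subspace) auto
    fix w assume w: "w \<in> ?U"
    show "X *v w \<in> ?U" "Z *v w \<in> ?U"
      by (rule span_closed_under[OF _ w], use XZ in blast)+
    show "Y *v w \<in> ?U" by (rule U_Y[OF w])
  qed simp
  then show ?thesis using U_p[of 0] assms(2) by (auto simp: p_0 p_def[symmetric])
qed

text \<open>The dimension of \<open>W\<close> fixes \<open>n\<close>, and \<open>D\<close> then
  fixes \<open>s\<close>. So the same \<open>s\<close> and \<open>n\<close> serve whichever
  generator takes the place of \<open>X\<close>, and the three endpoints agree.\<close>

lemma weights_unique: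
  assumes "D = 2 * s + n" "vec.dim W = Suc n" "i \<le> D"
  shows "(\<exists>w\<in>W. F i *v w \<noteq> 0) \<longleftrightarrow> s \<le> i \<and> i \<le> s + n"
proof (rule weights)
  fix s' n'
  assume "D = 2 * s' + n'" "vec.dim W = Suc n'"
    and supp: "\<And>i. i \<le> D \<Longrightarrow> (\<exists>w\<in>W. F i *v w \<noteq> 0) \<longleftrightarrow> s' \<le> i \<and> i \<le> s' + n'"
  then have "s' = s" "n' = n" using assms by simp_all
  then show ?thesis using supp assms(3) by simp
qed

text \<open>If \<open>G (s + i)\<close> killed \<open>u\<close>, it would kill all powers of
  \<open>Y\<close> applied to \<open>u\<close>, hence \<open>W\<close>, although this weight of
  \<open>Y\<close> occurs in \<open>W\<close>. So there are \<open>n + 1\<close> independent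
  eigenvectors in dimension \<open>n + 1\<close>.\<close>

lemma dual_eigenbasis:
  assumes G: "spectral_family D Y G"
    and dims: "D = 2 * s + n" "vec.dim W = Suc n"
    and u: "u \<in> W" "u \<noteq> 0" "X *v u = ev D s *s u"
  shows "inj_on (\<lambda>i. G (s + i) *v u) {0..n}"
    "vec.independent ((\<lambda>i. G (s + i) *v u) ` {0..n})"
    "vec.span ((\<lambda>i. G (s + i) *v u) ` {0..n}) = W"
proof -
  interpret G: su2_module D Y G X Z "- c" W by (rule spectral_swap[OF G])
  \<comment> \<open>No weight of \<open>X\<close> on \<open>W\<close> has index below
    \<open>s\<close>, so \<open>u\<close> is a highest weight vector.\<close>
  have raise: "raise u = 0"
    by (rule raise_highest[OF u(1,3)]) (meson weights_unique[OF dims] not_le)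
  have nz: "G (s + i) *v u \<noteq> 0" if "i \<le> n" for i
  proof
    assume 0: "G (s + i) *v u = 0"
    have i: "s + i \<le> D" using that dims by simp
    have "G (s + i) *v ((((*v) Y) ^^ k) u) = 0" for k
      by (induction k) (simp_all add: 0 G.eigen_right[OF i])
    then have "vec.span (range (\<lambda>k. (((*v) Y) ^^ k) u)) \<subseteq> {w. G (s + i) *v w = 0}"
      by (intro vec.span_minimal vec.subspace_kernel) auto
    then show False
      using highest_vector_cyclic[OF u raise] G.weights_unique[OF dims i] that by auto
  qed
  have eig: "Y *v (G (s + i) *v u) = ev D (s + i) *s (G (s + i) *v u)" if "i \<le> n" for i
    by (rule G.eigen_left) (use that dims in simp)
  let ?B = "(\<lambda>i. G (s + i) *v u) ` {0..n}"
  show inj: "inj_on (\<lambda>i. G (s + i) *v u) {0..n}" and ind: "vec.independent ?B"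
    using G.eigenvectors_independent[of n "\<lambda>i. G (s + i) *v u", OF nz eig] by blast+
  have sub: "?B \<subseteq> W"
    using G.proj_in_invariant_subspace[OF subspace closed(2) u(1)] dims by auto
  have "W \<subseteq> vec.span ?B"
    by (rule vec.card_ge_dim_independent[OF sub ind]) (simp add: dims(2) card_image[OF inj])
  then show "vec.span ?B = W"
    using vec.span_minimal[OF sub subspace] by blast
qed

end

section \<open>The hypercube\<close>

definition flip :: "'n::finite \<Rightarrow> 'n vertex \<Rightarrow> 'n vertex" where
  "flip k y = (\<chi> j. if j = k then \<not> y $ j else y $ j)"

text \<open>Signs and flips are Pauli matrices in one coordinate: \<open>A_mat\<close> is the sum of
  the flips, \<open>Astar_mat\<close> the sum of the signs, \<open>Aeps_mat\<close> the sum of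
  \<open>\<i>\<close> times sign times flip.\<close>

definition coord_sign :: "'n::finite vertex \<Rightarrow> 'n \<Rightarrow> complex" where
  "coord_sign y k = (if y $ k then - 1 else 1)"

lemma flip_nth [simp]: "flip k y $ j = (if j = k then \<not> y $ j else y $ j)"
  by (simp add: flip_def)

lemma flip_flip [simp]: "flip k (flip k y) = y"
  by (simp add: vec_eq_iff)

lemma flip_commute: "flip k (flip l y) = flip l (flip k y)"
  by (auto simp: vec_eq_iff)

lemma inj_flip: "inj (\<lambda>k. flip k y)"
  by (rule injI) (auto simp: vec_eq_iff split: if_splits)

lemma coord_sign_flip:
  "coord_sign (flip l y) k = (if k = l then - coord_sign y k else coord_sign y k)"
  by (simp add: coord_sign_def)

lemma cube_adj_iff_flip: "cube_adj y z \<longleftrightarrow> (\<exists>k. z = flip k y)"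
proof
  assume "cube_adj y z"
  then obtain k where k: "\<And>j. y $ j \<noteq> z $ j \<longleftrightarrow> j = k"
    unfolding cube_adj_def by metis
  have "z $ j = flip k y $ j" for j using k[of j] by auto
  then show "\<exists>k. z = flip k y" unfolding vec_eq_iff by blast
next
  assume "\<exists>k. z = flip k y"
  then obtain k where "z = flip k y" ..
  then show "cube_adj y z" unfolding cube_adj_def by (intro ex1I[of _ k]) (simp_all split: if_splits)
qed

text \<open>Flipping the differing coordinates one by one gives a walk of this length, and an edge
  changes their number by at most one.\<close>

lemma cube_dist_eq_card:
  fixes y z :: "'n::finite vertex"
  shows "cube_dist y z = card {k. y $ k \<noteq> z $ k}"
proof -
  have walk: "(cube_adj ^^ card {k. y $ k \<noteq> z $ k}) y z" for y z :: "'n vertex"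
  proof (induction "card {k. y $ k \<noteq> z $ k}" arbitrary: z)
    case 0
    then have "y = z" by (auto simp: vec_eq_iff)
    then show ?case by simp
  next
    case (Suc m)
    then have "{k. y $ k \<noteq> z $ k} \<noteq> {}" by force
    then obtain k where k: "y $ k \<noteq> z $ k" by blast
    have "{j. y $ j \<noteq> flip k z $ j} = {j. y $ j \<noteq> z $ j} - {k}" using k by auto
    then have m: "m = card {j. y $ j \<noteq> flip k z $ j}" using Suc.hyps(2) k by simp
    have "cube_adj (flip k z) z" by (metis cube_adj_iff_flip flip_flip)
    then show ?case
      using Suc.hyps(1)[OF m] unfolding Suc.hyps(2)[symmetric] m[symmetric] by auto
  qed
  have bound: "card {k. y $ k \<noteq> z $ k} \<le> m" if "(cube_adj ^^ m) y z" for m and z :: "'n vertex"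
    using that
  proof (induction m arbitrary: z)
    case (Suc m)
    from Suc.prems obtain w where "(cube_adj ^^ m) y w" "cube_adj w z" by auto
    then obtain k where w: "(cube_adj ^^ m) y w" "z = flip k w"
      using cube_adj_iff_flip by blast
    have "{j. y $ j \<noteq> z $ j} \<subseteq> insert k {j. y $ j \<noteq> w $ j}" by (auto simp: w(2))
    then have "card {j. y $ j \<noteq> z $ j} \<le> card (insert k {j. y $ j \<noteq> w $ j})"
      by (intro card_mono) auto
    also have "\<dots> \<le> Suc m" using Suc.IH[OF w(1)] by (simp add: card_insert_if)
    finally show ?case .
  qed simp
  show ?thesis
    unfolding cube_dist_def
  proof (rule Least_equality)
    show "(cube_adj ^^ card {k. y $ k \<noteq> z $ k}) y z" by (rule walk)
  qed (rule bound)
qed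

lemma sum_coord_sign:
  fixes y :: "'n::finite vertex"
  shows "(\<Sum>k\<in>UNIV. coord_sign y k) = ev CARD('n) (cube_dist base_vertex y)"
proof -
  have "(\<Sum>k\<in>UNIV. coord_sign y k) = (\<Sum>k\<in>UNIV. 1 - 2 * of_bool (y $ k))"
    by (rule sum.cong) (auto simp: coord_sign_def)
  also have "\<dots> = of_nat CARD('n) - 2 * (\<Sum>k\<in>UNIV. of_bool (y $ k))"
    by (simp add: sum_subtractf sum_distrib_left)
  finally show ?thesis
    by (simp add: ev_def cube_dist_eq_card base_vertex_def)
qed

lemma A_mat_apply: "(A_mat *v v) $ y = (\<Sum>k\<in>UNIV. v $ flip k y)"
proof -
  have "(A_mat *v v) $ y = (\<Sum>z\<in>UNIV. if cube_adj y z then v $ z else 0)"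
    by (auto simp: matrix_vector_mult_def A_mat_def intro!: sum.cong)
  also have "\<dots> = (\<Sum>z\<in>{z. cube_adj y z}. v $ z)"
    by (simp add: sum.If_cases)
  also have "{z. cube_adj y z} = range (\<lambda>k. flip k y)"
    by (auto simp: cube_adj_iff_flip)
  finally show ?thesis
    by (simp add: sum.reindex[OF inj_flip])
qed

lemma Astar_mat_apply_ev:
  "(Astar_mat *v v) $ y = ev CARD('n) (cube_dist base_vertex y) * v $ (y :: 'n::finite vertex)"
proof -
  have "(Astar_mat *v v) $ y
      = (\<Sum>z\<in>UNIV. if y = z then ev CARD('n) (cube_dist base_vertex y) * v $ y else 0)"
    unfolding matrix_vector_mult_def Astar_mat_def vec_lambda_beta ev_def
    by (rule sum.cong) auto
  then show ?thesis by simp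
qed

lemma Astar_mat_apply: "(Astar_mat *v v) $ y = (\<Sum>k\<in>UNIV. coord_sign y k) * v $ y"
  by (simp add: Astar_mat_apply_ev sum_coord_sign)

lemma smult_mat_apply: "smult_mat c M *v v = c *s (M *v v)"
  by (simp add: vec_eq_iff smult_mat_def matrix_vector_mult_def sum_distrib_left mult.assoc)

lemma sum_coord_sign_flip:
  "(\<Sum>j\<in>UNIV. coord_sign (flip k y) j) = (\<Sum>j\<in>UNIV. coord_sign y j) - 2 * coord_sign y k"
proof -
  have "(\<Sum>j\<in>UNIV. coord_sign (flip k y) j)
      = (\<Sum>j\<in>UNIV. coord_sign y j - (if j = k then 2 * coord_sign y k else 0))"
    by (rule sum.cong) (auto simp: coord_sign_flip)
  then show ?thesis by (simp add: sum_subtractf)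
qed

text \<open>A flip at \<open>k\<close> changes the diagonal entry of \<open>Astar_mat\<close> by
  \<open>- 2 * coord_sign y k\<close>. The commutator retains just this change, and
  \<open>- \<i> / 2\<close> times \<open>- 2\<close> is \<open>\<i>\<close>.\<close>

lemma Aeps_mat_apply: "(Aeps_mat *v v) $ y = \<i> * (\<Sum>k\<in>UNIV. coord_sign y k * v $ flip k y)"
proof -
  have "(Aeps_mat *v v) $ y
      = - \<i> / 2 * ((A_mat *v (Astar_mat *v v)) $ y - (Astar_mat *v (A_mat *v v)) $ y)"
    by (simp add: Aeps_mat_def smult_mat_apply matrix_vector_mult_diff_rdistrib
        matrix_vector_mul_assoc algebra_simps)
  also have "(A_mat *v (Astar_mat *v v)) $ y - (Astar_mat *v (A_mat *v v)) $ y
      = (\<Sum>k\<in>UNIV. - 2 * (coord_sign y k * v $ flip k y))"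
    unfolding A_mat_apply Astar_mat_apply sum_coord_sign_flip sum_distrib_left sum_subtractf[symmetric]
    by (rule sum.cong) (auto simp: algebra_simps)
  also have "\<dots> = - 2 * (\<Sum>k\<in>UNIV. coord_sign y k * v $ flip k y)"
    by (rule sum_distrib_left[symmetric])
  finally show ?thesis by (simp add: field_simps)
qed

section \<open>Commutation relations\<close>

lemma commutator_A_Astar:
  "A_mat *v (Astar_mat *v v) - Astar_mat *v (A_mat *v v) = (2 * \<i>) *s (Aeps_mat *v v)"
proof -
  have "(2 * \<i>) *s (Aeps_mat *v v) = (A_mat ** Astar_mat - Astar_mat ** A_mat) *v v"
    unfolding Aeps_mat_def smult_mat_apply vec.scale_scale by simp
  then show ?thesis
    by (simp only: matrix_vector_mult_diff_rdistrib matrix_vector_mul_assoc)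
qed

text \<open>The change of the diagonal entry meets the sign in \<open>Aeps_mat\<close>; the two
  equal signs multiply to 1 and leave plain flips.\<close>

lemma commutator_Astar_Aeps:
  "Astar_mat *v (Aeps_mat *v v) - Aeps_mat *v (Astar_mat *v v) = (2 * \<i>) *s (A_mat *v v)"
proof -
  have "(Astar_mat *v (Aeps_mat *v v)) $ y - (Aeps_mat *v (Astar_mat *v v)) $ y
      = (\<Sum>k\<in>UNIV. 2 * \<i> * v $ flip k y)" for y
    unfolding Aeps_mat_apply Astar_mat_apply sum_coord_sign_flip sum_distrib_left sum_subtractf[symmetric]
    by (rule sum.cong) (simp_all add: algebra_simps coord_sign_def)
  then show ?thesis by (simp add: vec_eq_iff A_mat_apply sum_distrib_left)
qed

text \<open>In the double sum over flips \<open>k\<close> and \<open>l\<close>, the terms with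
  \<open>k \<noteq> l\<close> cancel because flips commute. For \<open>k = l\<close> the flip
  reverses the sign, so these terms double.\<close>

lemma commutator_Aeps_A:
  "Aeps_mat *v (A_mat *v v) - A_mat *v (Aeps_mat *v v) = (2 * \<i>) *s (Astar_mat *v v)"
proof -
  have "(Aeps_mat *v (A_mat *v v)) $ y - (A_mat *v (Aeps_mat *v v)) $ y
      = 2 * \<i> * (\<Sum>k\<in>UNIV. coord_sign y k) * v $ y" for y
  proof -
    let ?g = "\<lambda>k l. \<i> * (coord_sign y k * v $ flip l (flip k y))"
    have 1: "(Aeps_mat *v (A_mat *v v)) $ y = (\<Sum>k\<in>UNIV. \<Sum>l\<in>UNIV. ?g k l)"
      by (simp add: Aeps_mat_apply A_mat_apply sum_distrib_left)
    have "(A_mat *v (Aeps_mat *v v)) $ y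
        = (\<Sum>l\<in>UNIV. \<Sum>k\<in>UNIV. ?g k l - (if k = l then 2 * \<i> * coord_sign y l * v $ y else 0))"
      unfolding Aeps_mat_apply A_mat_apply sum_distrib_left
      by (intro sum.cong refl) (auto simp: coord_sign_flip flip_commute)
    also have "\<dots> = (\<Sum>l\<in>UNIV. \<Sum>k\<in>UNIV. ?g k l) - (\<Sum>l\<in>UNIV. 2 * \<i> * coord_sign y l * v $ y)"
      by (simp add: sum_subtractf)
    also have "(\<Sum>l\<in>UNIV. \<Sum>k\<in>UNIV. ?g k l) = (\<Sum>k\<in>UNIV. \<Sum>l\<in>UNIV. ?g k l)"
      by (rule sum.swap)
    finally show ?thesis
      unfolding 1 by (simp add: sum_distrib_left sum_distrib_right)
  qed
  then show ?thesis by (simp add: vec_eq_iff Astar_mat_apply)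
qed

section \<open>The matrix \<open>P_mat\<close> as an intertwiner\<close>

lemma sum_flip: "(\<Sum>x\<in>UNIV. f (flip k x)) = (\<Sum>x\<in>UNIV. f x)"
  by (rule sum.reindex_bij_witness[of _ "flip k" "flip k"]) auto

lemma P_mat_nth: "P_mat $ y $ z = (\<Prod>k\<in>UNIV. P1 (y $ k) (z $ k))"
  by (simp add: P_mat_def)

lemma P_mat_flip_right: "P_mat $ y $ flip k z = coord_sign y k * P_mat $ y $ z"
proof -
  have "P1 (y $ k) (\<not> z $ k) = coord_sign y k * P1 (y $ k) (z $ k)"
    by (simp add: P1_def coord_sign_def)
  moreover
  have "(\<Prod>j\<in>UNIV - {k}. P1 (y $ j) (flip k z $ j)) = (\<Prod>j\<in>UNIV - {k}. P1 (y $ j) (z $ j))"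
    by (rule prod.cong) auto
  ultimately show ?thesis
    by (simp add: P_mat_nth prod.remove[of UNIV k])
qed

lemma P_mat_flip_left:
  "P_mat $ flip k y $ z = - \<i> * coord_sign y k * coord_sign z k * P_mat $ y $ z"
proof -
  have "P1 (\<not> y $ k) (z $ k) = - \<i> * coord_sign y k * coord_sign z k * P1 (y $ k) (z $ k)"
    by (simp add: P1_def coord_sign_def)
  moreover
  have "(\<Prod>j\<in>UNIV - {k}. P1 (flip k y $ j) (z $ j)) = (\<Prod>j\<in>UNIV - {k}. P1 (y $ j) (z $ j))"
    by (rule prod.cong) auto
  ultimately show ?thesis
    by (simp add: P_mat_nth prod.remove[of UNIV k])
qed

lemma P_mat_apply: "(P_mat *v v) $ y = (\<Sum>x\<in>UNIV. P_mat $ y $ x * v $ x)"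
  by (simp add: matrix_vector_mult_def)

text \<open>Reindexing moves each flip to the columns of \<open>P_mat\<close>, where it acts as a
  sign of the row. Thus \<open>P_mat\<close> diagonalizes \<open>A_mat\<close>.\<close>

lemma P_mat_A_mat: "P_mat *v (A_mat *v v) = Astar_mat *v (P_mat *v v)"
proof -
  have "(P_mat *v (A_mat *v v)) $ y = (Astar_mat *v (P_mat *v v)) $ y" for y
  proof -
    have "(P_mat *v (A_mat *v v)) $ y = (\<Sum>k\<in>UNIV. \<Sum>x\<in>UNIV. P_mat $ y $ x * v $ flip k x)"
      unfolding P_mat_apply A_mat_apply sum_distrib_left by (rule sum.swap)
    also have "\<dots> = (\<Sum>k\<in>UNIV. \<Sum>x\<in>UNIV. P_mat $ y $ flip k x * v $ x)"
      using sum_flip[of "\<lambda>x. P_mat $ y $ flip k x * v $ x" k for k] by simp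
    also have "\<dots> = (\<Sum>k\<in>UNIV. coord_sign y k * (P_mat *v v) $ y)"
      by (simp add: P_mat_flip_right P_mat_apply sum_distrib_left mult.assoc)
    finally show ?thesis by (simp add: Astar_mat_apply sum_distrib_right)
  qed
  then show ?thesis by (simp add: vec_eq_iff)
qed

text \<open>After the same reindexing, the signs of row and column combine with \<open>\<i>\<close>
  to the factor that a flip of the row produces.\<close>

lemma P_mat_Aeps_mat: "P_mat *v (Aeps_mat *v v) = A_mat *v (P_mat *v v)"
proof -
  have "(P_mat *v (Aeps_mat *v v)) $ y = (A_mat *v (P_mat *v v)) $ y" for y
  proof -
    let ?f = "\<lambda>k x. P_mat $ y $ x * (\<i> * (coord_sign x k * v $ flip k x))"
    have "(P_mat *v (Aeps_mat *v v)) $ y = (\<Sum>k\<in>UNIV. \<Sum>x\<in>UNIV. ?f k x)"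
      unfolding P_mat_apply Aeps_mat_apply sum_distrib_left by (rule sum.swap)
    also have "\<dots> = (\<Sum>k\<in>UNIV. \<Sum>x\<in>UNIV. ?f k (flip k x))"
      using sum_flip[of "?f k" k for k] by simp
    also have "\<dots> = (\<Sum>k\<in>UNIV. (P_mat *v v) $ flip k y)"
      unfolding P_mat_apply
      by (simp add: P_mat_flip_right P_mat_flip_left coord_sign_flip mult.assoc mult.left_commute)
    finally show ?thesis by (simp add: A_mat_apply)
  qed
  then show ?thesis by (simp add: vec_eq_iff)
qed

definition P1_inv :: "bool \<Rightarrow> bool \<Rightarrow> complex" where
  "P1_inv a b = (if \<not> b then 1 else if \<not> a then \<i> else - \<i>) / 2"

text \<open>Distributivity, with vertices read as functions to \<open>bool\<close>. It lets
  Kronecker powers be multiplied one coordinate at a time.\<close>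

lemma sum_prod_vertex:
  "(\<Sum>x\<in>UNIV. \<Prod>k\<in>UNIV. f k (x $ k)) = (\<Prod>k\<in>UNIV. f k False + f k True :: complex)"
  for f :: "'n::finite \<Rightarrow> bool \<Rightarrow> complex"
proof -
  have "(\<Prod>k\<in>UNIV. \<Sum>b\<in>UNIV. f k b) = (\<Sum>g\<in>UNIV. \<Prod>k\<in>UNIV. f k (g k))"
    using prod_sum_PiE[of UNIV "\<lambda>_. UNIV" f] by (simp add: PiE_UNIV_domain)
  also have "\<dots> = (\<Sum>x\<in>UNIV. \<Prod>k\<in>UNIV. f k (x $ k))"
    by (rule sum.reindex_bij_witness[of _ vec_nth vec_lambda]) auto
  finally show ?thesis by (simp add: UNIV_bool add.commute)
qed

lemma invertible_P_mat: "invertible P_mat"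
proof -
  let ?Q = "(\<chi> y z. \<Prod>k\<in>UNIV. P1_inv (y $ k) (z $ k)) :: 'n::finite cmat"
  have "(P_mat ** ?Q) $ y $ z = mat 1 $ y $ z" for y z
  proof -
    have "(P_mat ** ?Q) $ y $ z = (\<Sum>x\<in>UNIV. \<Prod>k\<in>UNIV. P1 (y $ k) (x $ k) * P1_inv (x $ k) (z $ k))"
      by (simp add: matrix_matrix_mult_def P_mat_nth prod.distrib)
    also have "\<dots> = (\<Prod>k\<in>UNIV. if y $ k = z $ k then 1 else 0)"
      unfolding sum_prod_vertex[of "\<lambda>k b. P1 (y $ k) b * P1_inv b (z $ k)"]
      by (rule prod.cong) (auto simp: P1_def P1_inv_def)
    also have "\<dots> = (if y = z then 1 else 0)"
      by (auto simp: vec_eq_iff prod_zero_iff)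
    finally show ?thesis by (simp add: mat_def)
  qed
  then have "P_mat ** ?Q = mat 1" unfolding vec_eq_iff by blast
  then show ?thesis
    unfolding invertible_def using matrix_left_right_inverse by blast
qed

section \<open>Primitive idempotents of the three matrices\<close>

lemma spectral_family_conjugate:
  fixes P X X' :: "complex ^ 'm::finite ^ 'm"
  assumes "spectral_family D X F" "invertible P" "\<And>v. P *v (X' *v v) = X *v (P *v v)"
  shows "spectral_family D X' (\<lambda>i. matrix_inv P ** F i ** P)"
proof -
  interpret spectral_family D X F by fact
  have inv: "P ** matrix_inv P = mat 1" "matrix_inv P ** P = mat 1"
    using someI_ex[OF assms(2)[unfolded invertible_def]] by (simp_all add: matrix_inv_def)
  have inv_P: "matrix_inv P *v (P *v v) = v" "P *v (matrix_inv P *v v) = v" for v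
    by (simp_all add: matrix_vector_mul_assoc inv)
  have X': "X' *v v = matrix_inv P *v (X *v (P *v v))" for v
    by (metis assms(3) inv_P(1))
  show ?thesis
  proof
    fix v
    have "(\<Sum>i\<le>D. matrix_inv P ** F i ** P *v v) = matrix_inv P *v (\<Sum>i\<le>D. F i *v (P *v v))"
      by (simp add: vec.sum matrix_vector_mul_assoc matrix_mul_assoc)
    then show "(\<Sum>i\<le>D. matrix_inv P ** F i ** P *v v) = v" by (simp add: resolution inv_P)
  qed (simp_all add: matrix_vector_mul_assoc[symmetric] X' inv_P eigen_left eigen_right vec.scale)
qed

lemma spectral_Astar: "spectral_family CARD('n) (Astar_mat :: 'n::finite cmat) Estar_mat"
proof -
  have E: "(Estar_mat i *v v) $ y = (if cube_dist base_vertex y = i then v $ y else 0)"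
    for i v and y :: "'n vertex"
  proof -
    have "(Estar_mat i *v v) $ y
        = (\<Sum>z\<in>UNIV. if y = z then if cube_dist base_vertex y = i then v $ y else 0 else 0)"
      unfolding matrix_vector_mult_def Estar_mat_def vec_lambda_beta
      by (rule sum.cong) auto
    then show ?thesis by simp
  qed
  have "cube_dist base_vertex y \<le> CARD('n)" for y :: "'n vertex"
    unfolding cube_dist_eq_card by (rule card_mono) auto
  then show ?thesis
    by unfold_locales (auto simp: vec_eq_iff E Astar_mat_apply_ev)
qed

lemma E_mat_apply: "E_mat i *v v = lagrange_proj CARD('n) A_mat i (v :: 'n::finite cvec)"
proof -
  have theta: "theta TYPE('n) j = ev CARD('n) j" for j
    by (simp add: theta_def ev_def)
  have "foldr (**) (map (\<lambda>j. smult_mat (1 / (theta TYPE('n) i - theta TYPE('n) j))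
        (A_mat - smult_mat (theta TYPE('n) j) (mat 1))) xs) (mat 1) *v v
      = foldr (\<lambda>j w. (1 / (ev CARD('n) i - ev CARD('n) j)) *s (A_mat *v w - ev CARD('n) j *s w)) xs v"
    for xs
    by (induction xs)
      (simp_all add: theta matrix_vector_mul_assoc[symmetric] smult_mat_apply
        matrix_vector_mult_diff_rdistrib)
  then show ?thesis unfolding E_mat_def lagrange_proj_def .
qed

text \<open>Conjugating the diagonal family of \<open>Astar_mat\<close> by \<open>P_mat\<close>
  gives a spectral family of \<open>A_mat\<close>. Its members are Lagrange polynomials in
  \<open>A_mat\<close>, so they act as the \<open>E_mat i\<close>.\<close>

lemma spectral_A: "spectral_family CARD('n) (A_mat :: 'n::finite cmat) E_mat"
proof -
  let ?F = "\<lambda>i. matrix_inv P_mat ** Estar_mat i ** P_mat :: 'n cmat"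
  interpret F: spectral_family "CARD('n)" A_mat ?F
    by (rule spectral_family_conjugate[OF spectral_Astar invertible_P_mat P_mat_A_mat])
  have E_eq: "E_mat i *v v = ?F i *v v" if "i \<le> CARD('n)" for i v
    using F.lagrange_proj_eq[OF that] by (simp only: E_mat_apply)
  show ?thesis
  proof
    fix i and v :: "'n cvec"
    assume i: "i \<le> CARD('n)"
    show "A_mat *v (E_mat i *v v) = ev CARD('n) i *s (E_mat i *v v)"
      unfolding E_eq[OF i] by (rule F.eigen_left[OF i])
    show "E_mat i *v (A_mat *v v) = ev CARD('n) i *s (E_mat i *v v)"
      unfolding E_eq[OF i] by (rule F.eigen_right[OF i])
  next
    fix v :: "'n cvec"
    have "(\<Sum>i\<le>CARD('n). E_mat i *v v) = (\<Sum>i\<le>CARD('n). ?F i *v v)"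
      by (rule sum.cong) (simp_all only: E_eq atMost_iff)
    then show "(\<Sum>i\<le>CARD('n). E_mat i *v v) = v" by (simp only: F.resolution)
  qed
qed

lemma spectral_Aeps: "spectral_family CARD('n) (Aeps_mat :: 'n::finite cmat) Eeps_mat"
  unfolding Eeps_mat_def[abs_def]
  by (rule spectral_family_conjugate[OF spectral_A invertible_P_mat P_mat_Aeps_mat])

section \<open>Modules over \<open>T_alg\<close> and the six representations\<close>

lemma T_module_iff:
  "T_module U \<longleftrightarrow> vec.subspace U \<and> (\<forall>w\<in>U. A_mat *v w \<in> U) \<and> (\<forall>w\<in>U. Astar_mat *v w \<in> U)"
proof (intro iffI conjI)
  assume U: "vec.subspace U \<and> (\<forall>w\<in>U. A_mat *v w \<in> U) \<and> (\<forall>w\<in>U. Astar_mat *v w \<in> U)"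
  \<comment> \<open>The matrices preserving \<open>U\<close> form a subalgebra; it contains both
    generators, hence their hull.\<close>
  let ?S = "{M. \<forall>w\<in>U. M *v w \<in> U}"
  have "is_subalgebra ?S"
    unfolding is_subalgebra_def using U
    by (auto simp: matrix_vector_mult_add_rdistrib matrix_vector_mul_assoc[symmetric]
        smult_mat_apply intro: vec.subspace_add vec.subspace_scale)
  then have "T_alg \<subseteq> ?S"
    unfolding T_alg_def using U by (intro hull_minimal) auto
  then show "T_module U" unfolding T_module_def using U by auto
next
  assume U: "T_module U"
  then show "vec.subspace U" by (simp add: T_module_def)
  have "A_mat \<in> T_alg" "Astar_mat \<in> T_alg" unfolding T_alg_def by (simp_all add: hull_inc)
  then show "\<forall>w\<in>U. A_mat *v w \<in> U" "\<forall>w\<in>U. Astar_mat *v w \<in> U"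
    using U by (auto simp: T_module_def)
qed

text \<open>\<open>Aeps_mat\<close> is a multiple of a commutator, so it preserves \<open>W\<close>.
  The structure constant \<open>2 * \<i>\<close> has square \<open>- 4\<close>.\<close>

lemma su2_module_of_irreducible:
  assumes "irreducible_T_module (W :: 'n::finite cvec set)"
  shows "su2_module CARD('n) A_mat E_mat Astar_mat Aeps_mat (2 * \<i>) W"
proof -
  interpret spectral_family "CARD('n)" "A_mat :: 'n cmat" E_mat by (rule spectral_A)
  have W: "vec.subspace W" "\<And>w. w \<in> W \<Longrightarrow> A_mat *v w \<in> W" "\<And>w. w \<in> W \<Longrightarrow> Astar_mat *v w \<in> W"
    and nz: "W \<noteq> {0}"
    and irr: "\<And>U. T_module U \<Longrightarrow> U \<subseteq> W \<Longrightarrow> U = {0} \<or> U = W"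
    using assms by (auto simp: irreducible_T_module_def T_module_iff)
  have "Aeps_mat *v w \<in> W" if "w \<in> W" for w
  proof -
    have "Aeps_mat *v w
        = (- \<i> / 2) *s (A_mat *v (Astar_mat *v w) - Astar_mat *v (A_mat *v w))"
      by (simp only: Aeps_mat_def smult_mat_apply matrix_vector_mult_diff_rdistrib
          matrix_vector_mul_assoc)
    also have "\<dots> \<in> W" by (intro vec.subspace_scale vec.subspace_diff W that)
    finally show ?thesis .
  qed
  then show ?thesis
    using W nz irr
    by unfold_locales
      (simp_all add: commutator_A_Astar commutator_Astar_Aeps commutator_Aeps_A T_module_iff)
qed

text \<open>Each of the six claims is one instance: \<open>u\<close> lies in the first eigenspace of
  \<open>X\<close> on \<open>W\<close> and is decomposed by the idempotents of
  \<open>Y\<close>.\<close>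

lemma represents_dual:
  fixes W :: "'n::finite cvec set"
  assumes "su2_module CARD('n) X F Y Z c W" "spectral_family CARD('n) Y G"
    and dims: "CARD('n) = 2 * s + n" "vec.dim W = Suc n"
    and u: "u \<in> mat_image (F s) W" "u \<noteq> 0"
  shows "represents n (diag_mat n) Y (\<lambda>i. G (s + i) *v u) W"
proof -
  interpret su2_module "CARD('n)" X F Y Z c W by fact
  interpret G: spectral_family "CARD('n)" Y G by fact
  have s: "s \<le> CARD('n)" using dims by simp
  obtain w where w: "w \<in> W" "u = F s *v w" using u by (auto simp: mat_image_def)
  have "u \<in> W" "X *v u = ev CARD('n) s *s u"
    using proj_in_invariant_subspace[OF subspace closed(1) w(1) s] eigen_left[OF s] by (auto simp: w(2))
  note basis = dual_eigenbasis[OF G.spectral_family_axioms dims this(1) u(2) this(2)]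
  have "Y *v (G (s + j) *v u) = (\<Sum>i = 0..n. diag_mat n i j *s (G (s + i) *v u))" if "j \<le> n" for j
  proof -
    have "(\<Sum>i = 0..n. diag_mat n i j *s (G (s + i) *v u))
        = (\<Sum>i = 0..n. if i = j then ev n j *s (G (s + j) *v u) else 0)"
      by (rule sum.cong) (auto simp: diag_mat_def ev_def)
    also have "\<dots> = ev n j *s (G (s + j) *v u)" using that by simp
    \<comment> \<open>As \<open>D = 2 * s + n\<close>, the shift by \<open>s\<close> turns
      eigenvalues for \<open>D\<close> into those for \<open>n\<close>.\<close>
    also have "ev n j = ev CARD('n) (s + j)" by (simp add: dims(1) ev_def)
    finally show ?thesis using G.eigen_left[of "s + j" u] that dims(1) by simp
  qed
  then show ?thesis unfolding represents_def is_basis_seq_def using basis by blast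
qed

theorem theorem10p1:
  fixes W :: "(complex ^ (bool ^ 'n::finite)) set"
    and r d :: nat
    and u ustar ueps :: "complex ^ (bool ^ 'n)"
  assumes "irreducible_T_module W"
    and "r = endpoint W"
    and "d = diameter_mod W"
    and "u \<in> mat_image (E_mat r) W" and "u \<noteq> 0"
    and "ustar \<in> mat_image (Estar_mat r) W" and "ustar \<noteq> 0"
    and "ueps \<in> mat_image (Eeps_mat r) W" and "ueps \<noteq> 0"
  shows "(represents d (diag_mat d) A_mat (\<lambda>i. E_mat (r + i) *v ustar) W
        \<and> represents d (diag_mat d) A_mat (\<lambda>i. E_mat (r + i) *v ueps) W)
    \<and> (represents d (diag_mat d) Astar_mat (\<lambda>i. Estar_mat (r + i) *v u) W
        \<and> represents d (diag_mat d) Astar_mat (\<lambda>i. Estar_mat (r + i) *v ueps) W)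
    \<and> (represents d (diag_mat d) Aeps_mat (\<lambda>i. Eeps_mat (r + i) *v u) W
        \<and> represents d (diag_mat d) Aeps_mat (\<lambda>i. Eeps_mat (r + i) *v ustar) W)"
proof -
  \<comment> \<open>The six orderings of the generators: the first supplies the vector, the second
    is the matrix to be represented.\<close>
  note A = su2_module_of_irreducible[OF assms(1)]
  note A' = su2_module.swap_YZ[OF A]
  note Astar = su2_module.spectral_swap[OF A spectral_Astar]
  note Astar' = su2_module.swap_YZ[OF Astar]
  note Aeps = su2_module.spectral_swap[OF A' spectral_Aeps]
  note Aeps' = su2_module.swap_YZ[OF Aeps]
  interpret Astar: su2_module "CARD('n)" Astar_mat Estar_mat A_mat Aeps_mat "- (2 * \<i>)" W
    by (rule Astar)
  obtain s n where dims: "CARD('n) = 2 * s + n" "vec.dim W = Suc n"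
    and supp: "\<And>i. i \<le> CARD('n) \<Longrightarrow> (\<exists>w\<in>W. Estar_mat i *v w \<noteq> 0) \<longleftrightarrow> s \<le> i \<and> i \<le> s + n"
    by (rule Astar.weights) (rule that)
  have image: "mat_image (Estar_mat i) W \<noteq> {0} \<longleftrightarrow> (\<exists>w\<in>W. Estar_mat i *v w \<noteq> 0)" for i
    using vec.subspace_0[OF Astar.subspace] by (force simp: mat_image_def)
  have "i \<in> module_support W \<longleftrightarrow> i \<in> {s..s + n}" for i
    unfolding module_support_def mem_Collect_eq image atLeastAtMost_iff
    using supp[of i] dims(1) by (metis add.commute add_le_mono1 le_add2 le_trans mult_2)
  then have "module_support W = {s..s + n}" by blast
  \<comment> \<open>\<open>endpoint\<close> and \<open>diameter_mod\<close> refer to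
    \<open>Astar_mat\<close> alone, but \<open>s\<close> and \<open>n\<close> depend only on
    dimensions and so fit all three generators.\<close>
  then have "r = s" "d = n"
    using assms(2,3) by (simp_all add: endpoint_def diameter_mod_def Min_eq_iff)
  note dims = dims[folded this]
  show ?thesis
    using represents_dual[OF Astar spectral_A dims assms(6,7)]
      represents_dual[OF Aeps spectral_A dims assms(8,9)]
      represents_dual[OF A spectral_Astar dims assms(4,5)]
      represents_dual[OF Aeps' spectral_Astar dims assms(8,9)]
      represents_dual[OF A' spectral_Aeps dims assms(4,5)]
      represents_dual[OF Astar' spectral_Aeps dims assms(6,7)]
    by blast
qed

end
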